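(* Let $G=(L\cup R,A)$ be a relevant directed graph, i.e. $G\in\mathcal{S}$. Then for each $K\in\{R,L\}$, $s^K_1(G)\geq s^K_2(G)$.
   Context: **Game.** A position is a finite directed graph $G=(L\cup R,A)$ whose vertex set $V(G)=L\cup R$ is partitioned into $L=L(G)$ and $R=R(G)$. For $S\subseteq V(G)$, $G\setminus S$ is the subgraph induced on $V(G)\setminus S$. $\mathrm{Succ}(G,x)$ (resp. $\mathrm{Pred}(G,x)$) is the set of vertices reachable from $x$ (resp. that can reach $x$) by a directed path, including $x$. Left and Right alternate; Left chooses $x\in L$ and removes $\mathrm{Succ}(G,x)$, Right chooses $y\in R$ and removes $\mathrm{Pred}(G,y)$; a player's score is the number of vertices he removed. **Relevant graphs.** $\mathrm{Forc}(G)=\{x\in L:\mathrm{Succ}(G,x)\subseteq L\}\cup\{y\in R:\mathrm{Pred}(G,y)\subseteq R\}$; $G$ is relevant if $\mathrm{Forc}(G)=\emptyset$, and $\mathcal{S}$ is the class of relevant graphs. On relevant graphs, forced vertices created by a move are immediately given to the player who moved: for $x\in L$, $\mathrm{Rmv}(G,x)=\mathrm{Succ}(G,x)\cup\mathrm{Forc}(G\setminus\mathrm{Succ}(G,x))$; for $y\in R$, $\mathrm{Rmv}(G,y)=\mathrm{Pred}(G,y)\cup\mathrm{Forc}(G\setminus\mathrm{Pred}(G,y))$; and $G_u=G\setminus\mathrm{Rmv}(G,u)$, again in $\mathcal{S}$. **Scores.** $s^L_1(G)$ (resp. $s^L_2(G)$) is Left's optimal score when Left (resp. Right) starts, and $s^R_1(G)$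 (resp. $s^R_2(G)$) is Right's optimal score when Right (resp. Left) starts. All are $0$ on the empty graph and, for nonempty $G\in\mathcal{S}$, $s^L_1(G)=\max_{x\in L}\{|\mathrm{Rmv}(G,x)|+s^L_2(G_x)\}$, $s^L_2(G)=\min_{y\in R}s^L_1(G_y)$, $s^R_1(G)=\max_{y\in R}\{|\mathrm{Rmv}(G,y)|+s^R_2(G_y)\}$, $s^R_2(G)=\min_{x\in L}s^R_1(G_x)$. *)

theory Defs
  imports "Graph_Theory.Graph_Theory"
begin

datatype player = Left | Right

primrec opponent :: "player \<Rightarrow> player" where
  "opponent Left = Right"
| "opponent Right = Left"

record 'a position =
  lefts :: "'a set"
  rights :: "'a set"
  pos_arcs :: "('a \<times> 'a) set"

definition pos_digraph :: "'a position \<Rightarrow> 'a pair_pre_digraph" where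
  "pos_digraph G = \<lparr> pverts = lefts G \<union> rights G, parcs = pos_arcs G \<rparr>"

(* Loops are allowed; they do not affect reachability. *)
definition game_position :: "'a position \<Rightarrow> bool" where
  "game_position G \<longleftrightarrow> pair_fin_digraph (pos_digraph G) \<and> lefts G \<inter> rights G = {}"

abbreviation pos_verts :: "'a position \<Rightarrow> 'a set" where
  "pos_verts G \<equiv> verts (pos_digraph G)"

primrec owned :: "player \<Rightarrow> 'a position \<Rightarrow> 'a set" where
  "owned Left G = lefts G"
| "owned Right G = rights G"

definition delete :: "'a position \<Rightarrow> 'a set \<Rightarrow> 'a position" where
  "delete G S = \<lparr> lefts = lefts G - S, rights = rights G - S,
     pos_arcs = {(u, v) \<in> pos_arcs G. u \<in> pos_verts G - S \<and> v \<in> pos_verts G - S} \<rparr>"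

lemma pos_digraph_delete:
  "with_proj (pos_digraph (delete G S)) = with_proj (pos_digraph G) \<restriction> (pos_verts G - S)"
  by (auto simp: with_proj_def pos_digraph_def delete_def induce_subgraph_def)

definition Succ :: "'a position \<Rightarrow> 'a \<Rightarrow> 'a set" where
  "Succ G x = {y. x \<rightarrow>\<^sup>*\<^bsub>pos_digraph G\<^esub> y}"

definition Pred :: "'a position \<Rightarrow> 'a \<Rightarrow> 'a set" where
  "Pred G x = {y. y \<rightarrow>\<^sup>*\<^bsub>pos_digraph G\<^esub> x}"

definition Forc :: "'a position \<Rightarrow> 'a set" where
  "Forc G = {x \<in> lefts G. Succ G x \<subseteq> lefts G} \<union> {y \<in> rights G. Pred G y \<subseteq> rights G}"

definition relevant :: "'a position \<Rightarrow> bool" where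
  "relevant G \<longleftrightarrow> game_position G \<and> Forc G = {}"

definition Rmv :: "'a position \<Rightarrow> 'a \<Rightarrow> 'a set" where
  "Rmv G u = (if u \<in> lefts G then Succ G u \<union> Forc (delete G (Succ G u))
              else Pred G u \<union> Forc (delete G (Pred G u)))"

definition after :: "'a position \<Rightarrow> 'a \<Rightarrow> 'a position" where
  "after G u = delete G (Rmv G u)"

lemma self_in_Rmv: "u \<in> pos_verts G \<Longrightarrow> u \<in> Rmv G u"
  by (auto simp: Rmv_def Succ_def Pred_def reachable_def)

lemma card_after_less:
  assumes "finite (pos_verts G)" "u \<in> pos_verts G"
  shows "card (pos_verts (after G u)) < card (pos_verts G)"
proof (rule psubset_card_mono[OF assms(1)])
  show "pos_verts (after G u) \<subset> pos_verts G"
    using self_in_Rmv[OF assms(2)] assms(2)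
    by (auto simp: after_def delete_def pos_digraph_def)
qed

lemma owned_subset_verts: "owned K G \<subseteq> pos_verts G"
  by (cases K) (auto simp: pos_digraph_def)

(* score_first K G and score_second K G are the optimal scores of player K when K, respectively
   the opponent of K, starts. The values matter only on relevant positions: there both players
   own a vertex unless the position is empty, so Max and Min range over nonempty finite sets,
   and after G u is relevant again (see relevant_after). *)
function score_first :: "player \<Rightarrow> 'a position \<Rightarrow> nat"
  and score_second :: "player \<Rightarrow> 'a position \<Rightarrow> nat" where
  "score_first K G = (if finite (pos_verts G) \<and> pos_verts G \<noteq> {}
     then Max ((\<lambda>u. card (Rmv G u) + score_second K (after G u)) ` owned K G) else 0)"
| "score_second K G = (if finite (pos_verts G) \<and> pos_verts G \<noteq> {}
     then Min ((\<lambda>u. score_first K (after G u)) ` owned (opponent K) G) else 0)"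
  by pat_completeness auto
termination
  by (relation "measure (\<lambda>s. case s of Inl (K, G) \<Rightarrow> card (pos_verts G)
        | Inr (K, G) \<Rightarrow> card (pos_verts G))")
     (auto intro!: card_after_less dest!: subsetD[OF owned_subset_verts] simp del: with_proj_simps)

declare score_first.simps [simp del] score_second.simps [simp del]

lemma game_position_delete: "game_position G \<Longrightarrow> game_position (delete G S)"
  unfolding game_position_def pair_fin_digraph_def pair_fin_digraph_axioms_def pair_wf_digraph_def
  by (auto simp: delete_def pos_digraph_def
      intro: finite_subset[where B = "pos_arcs G"])

lemma relevant_owned_nonempty:
  assumes "relevant G" "pos_verts G \<noteq> {}"
  shows "owned K G \<noteq> {}"
proof
  assume e: "owned K G = {}"
  have fin: "pair_fin_digraph (pos_digraph G)"
    using assms(1) by (simp add: relevant_def game_position_def)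
  interpret pair_fin_digraph "pos_digraph G" by (rule fin)
  have 1: "y \<in> pos_verts G" if "y \<in> Succ G x \<or> y \<in> Pred G x" for x y
    using that by (auto simp: Succ_def Pred_def dest: reachable_in_verts)
  show False
  proof (cases K)
    case Left
    then have "Forc G = rights G" using e 1 by (auto simp: Forc_def pos_digraph_def)
    then show False using Left e assms by (auto simp: relevant_def pos_digraph_def)
  next
    case Right
    then have "Forc G = lefts G" using e 1 by (auto simp: Forc_def pos_digraph_def)
    then show False using Right e assms by (auto simp: relevant_def pos_digraph_def)
  qed
qed

lemma delete_delete: "delete (delete G S) T = delete G (S \<union> T)"
  by (auto simp: delete_def pos_digraph_def)

lemma relevant_delete_Forc:
  assumes pos: "game_position G"
  shows "relevant (delete G (Forc G))"
proof -
  let ?H = "delete G (Forc G)"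
  have fin: "pair_fin_digraph (pos_digraph G)" and disj: "lefts G \<inter> rights G = {}"
    using pos by (simp_all add: game_position_def)
  interpret pair_fin_digraph "pos_digraph G" by (rule fin)
  have pv: "pverts (pos_digraph G) = lefts G \<union> rights G" by (simp add: pos_digraph_def)
  have survive: "w \<notin> Forc G"
    if "x \<rightarrow>\<^sup>*\<^bsub>pos_digraph G\<^esub> w" "w \<rightarrow>\<^sup>*\<^bsub>pos_digraph G\<^esub> y" "x \<in> lefts G" "y \<in> rights G" for x w y
    using that disj by (auto simp: Forc_def Succ_def Pred_def)
  have in_H: "x \<rightarrow>\<^sup>*\<^bsub>pos_digraph ?H\<^esub> y"
    if xy: "x \<rightarrow>\<^sup>*\<^bsub>pos_digraph G\<^esub> y" and x: "x \<in> lefts G" and y: "y \<in> rights G" for x y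
  proof -
    have "z \<rightarrow>\<^sup>*\<^bsub>pos_digraph ?H\<^esub> y" if "z \<rightarrow>\<^sup>*\<^bsub>pos_digraph G\<^esub> y" "x \<rightarrow>\<^sup>*\<^bsub>pos_digraph G\<^esub> z" for z
      using that
    proof (induct rule: converse_reachable_induct)
      case base
      then have "y \<in> pos_verts ?H"
        using survive[OF xy reachable_refl x y] y by (simp add: pos_digraph_def delete_def)
      then show ?case by (simp add: reachable_def)
    next
      case (step u v)
      have xv: "x \<rightarrow>\<^sup>*\<^bsub>pos_digraph G\<^esub> v"
        using step.prems step.hyps(1) by (rule reachable_adj_trans)
      have uy: "u \<rightarrow>\<^sup>*\<^bsub>pos_digraph G\<^esub> y"
        using step.hyps(1,2) by (rule adj_reachable_trans)
      have "u \<notin> Forc G" "v \<notin> Forc G"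
        using survive step.prems uy xv step.hyps(2) x y by blast+
      moreover have "u \<in> pos_verts G" "v \<in> pos_verts G"
        using step.hyps(1) adj_in_verts by auto
      moreover have "(u, v) \<in> pos_arcs G"
        using step.hyps(1) by (simp add: pos_digraph_def)
      ultimately have "(u, v) \<in> pos_arcs ?H" "u \<in> pos_verts ?H"
        by (auto simp: delete_def pos_digraph_def)
      then show ?case
        using step.hyps(3)[OF xv] unfolding reachable_def
        by (auto simp: pos_digraph_def intro: converse_rtrancl_on_into_rtrancl_on)
    qed
    moreover have "x \<in> pverts (pos_digraph G)" using x by (simp add: pos_digraph_def)
    ultimately show ?thesis using xy reachable_refl by blast
  qed
  have "Forc ?H = {}"
  proof (rule ccontr)
    assume "Forc ?H \<noteq> {}"
    then obtain z where "z \<in> Forc ?H" by blast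
    then consider (l) "z \<in> lefts ?H" "Succ ?H z \<subseteq> lefts ?H"
      | (r) "z \<in> rights ?H" "Pred ?H z \<subseteq> rights ?H"
      by (auto simp: Forc_def)
    then show False
    proof cases
      case l
      then have z: "z \<in> lefts G" "z \<notin> Forc G" by (auto simp: delete_def)
      then obtain y where "y \<in> Succ G z" "y \<notin> lefts G" by (auto simp: Forc_def)
      then have zy: "z \<rightarrow>\<^sup>*\<^bsub>pos_digraph G\<^esub> y" "y \<in> rights G"
        using pv by (auto simp: Succ_def dest: reachable_in_verts)
      then have "y \<in> Succ ?H z" using in_H z by (auto simp: Succ_def)
      then show False using l zy disj by (auto simp: delete_def)
    next
      case r
      then have z: "z \<in> rights G" "z \<notin> Forc G" by (auto simp: delete_def)
      then obtain y where "y \<in> Pred G z" "y \<notin> rights G" by (auto simp: Forc_def)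
      then have zy: "y \<rightarrow>\<^sup>*\<^bsub>pos_digraph G\<^esub> z" "y \<in> lefts G"
        using pv by (auto simp: Pred_def dest: reachable_in_verts)
      then have "y \<in> Pred ?H z" using in_H z by (auto simp: Pred_def)
      then show False using r zy disj by (auto simp: delete_def)
    qed
  qed
  then show ?thesis using pos by (simp add: relevant_def game_position_delete)
qed

lemma relevant_after: "relevant G \<Longrightarrow> relevant (after G u)"
  using relevant_delete_Forc[OF game_position_delete]
  by (auto simp: after_def Rmv_def relevant_def simp flip: delete_delete)

end

theory Submission
  imports Defs
begin

text \<open>Only the bipartite relation ``a left vertex reaches a right vertex'' matters: a player who moves
  at \<open>u\<close> removes the opponent's vertices related to \<open>u\<close> together with all his own vertices whose
  neighbourhood lies in that of \<open>u\<close>. Say that \<open>H\<close> is a trimming of \<open>G\<close> for player \<open>K\<close> if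
  it arises by dropping vertices of \<open>K\<close> (and then the isolated vertices of the opponent), so that the
  surviving vertices of \<open>K\<close> keep their whole neighbourhoods. By simultaneous induction on the size,
  trimming never raises the score of \<open>K\<close>, and starting is at least as good as not starting. In
  \<open>G\<close>, player \<open>K\<close> copies his moves from \<open>H\<close>; when the opponent plays a vertex missing in \<open>H\<close>,
  this amounts to a pass in \<open>H\<close>, which the claim for the smaller position \<open>H\<close> covers. Finally,
  an opponent's move turns \<open>G\<close> into a trimming of \<open>G\<close>.\<close>

section \<open>Reachability as seen by either player\<close>

lemma opponent_opponent [simp]: "opponent (opponent K) = K"
  by (cases K) auto

lemma pos_verts_owned: "pos_verts G = owned K G \<union> owned (opponent K) G"
  by (cases K) (auto simp: pos_digraph_def)

lemma owned_delete: "owned K (delete G S) = owned K G - S"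
  by (cases K) (auto simp: delete_def)

lemma owned_disjoint: "game_position G \<Longrightarrow> owned K G \<inter> owned (opponent K) G = {}"
  by (cases K) (auto simp: game_position_def)

text \<open>Right removes predecessors, so the arcs are reversed for Right; this lets every later
  statement treat both players at once.\<close>

primrec reaches :: "player \<Rightarrow> 'a position \<Rightarrow> 'a \<Rightarrow> 'a \<Rightarrow> bool" where
  "reaches Left G x y \<longleftrightarrow> x \<rightarrow>\<^sup>*\<^bsub>pos_digraph G\<^esub> y"
| "reaches Right G x y \<longleftrightarrow> y \<rightarrow>\<^sup>*\<^bsub>pos_digraph G\<^esub> x"

lemma reaches_opponent: "reaches (opponent K) G x y \<longleftrightarrow> reaches K G y x"
  by (cases K) auto

lemma
  assumes "game_position G"
  shows reaches_in_verts: "reaches K G x y \<Longrightarrow> x \<in> pos_verts G \<and> y \<in> pos_verts G"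
    and reaches_trans: "reaches K G x y \<Longrightarrow> reaches K G y z \<Longrightarrow> reaches K G x z"
proof -
  interpret pair_fin_digraph "pos_digraph G"
    using assms by (simp add: game_position_def)
  show "reaches K G x y \<Longrightarrow> x \<in> pos_verts G \<and> y \<in> pos_verts G"
    by (cases K) (auto dest: reachable_in_verts)
  show "reaches K G x y \<Longrightarrow> reaches K G y z \<Longrightarrow> reaches K G x z"
    by (cases K) (auto intro: reachable_trans)
qed

text \<open>Every vertex on a path from \<open>x\<close> to \<open>y\<close> is reached from
  \<open>x\<close> and reaches \<open>y\<close>. If \<open>D\<close> contains no such vertex, every
  such path survives; conversely, deletion creates no path.\<close>

lemma reaches_delete_iff:
  assumes pos: "game_position G"
    and avoid: "\<And>z. reaches K G x z \<Longrightarrow> reaches K G z y \<Longrightarrow> z \<notin> D"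
  shows "reaches K (delete G D) x y \<longleftrightarrow> reaches K G x y"
proof -
  interpret pair_fin_digraph "pos_digraph G"
    using pos by (simp add: game_position_def)
  have down: "u \<rightarrow>\<^sup>*\<^bsub>pos_digraph G\<^esub> v" if "u \<rightarrow>\<^sup>*\<^bsub>pos_digraph (delete G D)\<^esub> v" for u v
    using that unfolding reachable_def
    by (rule rtrancl_on_mono[rotated 2]) (auto simp: pos_digraph_def delete_def)
  have up: "u \<rightarrow>\<^sup>*\<^bsub>pos_digraph (delete G D)\<^esub> v"
    if uv: "u \<rightarrow>\<^sup>*\<^bsub>pos_digraph G\<^esub> v"
      and free: "\<And>z. u \<rightarrow>\<^sup>*\<^bsub>pos_digraph G\<^esub> z \<Longrightarrow> z \<rightarrow>\<^sup>*\<^bsub>pos_digraph G\<^esub> v \<Longrightarrow> z \<notin> D" for u v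
    using uv free
  proof (induct rule: converse_reachable_induct)
    case base
    then have "v \<in> pos_verts (delete G D)"
      using reachable_refl by (simp add: pos_digraph_def delete_def)
    then show ?case by (simp add: reachable_def)
  next
    case (step a b)
    have av: "a \<rightarrow>\<^sup>*\<^bsub>pos_digraph G\<^esub> v" and ab: "a \<rightarrow>\<^sup>*\<^bsub>pos_digraph G\<^esub> b"
      using step.hyps(1,2) by (auto intro: adj_reachable_trans)
    have inG: "a \<in> pos_verts G" "b \<in> pos_verts G"
      using step.hyps(1) adj_in_verts by auto
    have "a \<notin> D" "b \<notin> D"
      using step.prems[OF _ av] step.prems[OF ab step.hyps(2)] inG(1) by auto
    with inG have "(a, b) \<in> pos_arcs (delete G D)" "a \<in> pos_verts (delete G D)"
      using step.hyps(1) by (auto simp: delete_def pos_digraph_def)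
    \<comment> \<open>What lies between \<open>b\<close> and \<open>v\<close> also lies between
      \<open>a\<close> and \<open>v\<close>, so it avoids \<open>D\<close> as the induction
      hypothesis requires.\<close>
    moreover have "b \<rightarrow>\<^sup>*\<^bsub>pos_digraph (delete G D)\<^esub> v"
      by (rule step.hyps(3)) (erule step.prems[OF reachable_trans[OF ab]])
    ultimately show ?case
      unfolding reachable_def
      by (auto simp: pos_digraph_def intro: converse_rtrancl_on_into_rtrancl_on)
  qed
  show ?thesis
  proof (cases K)
    case Left then show ?thesis using down up avoid by auto
  next
    case Right then show ?thesis using down up avoid by auto
  qed
qed

section \<open>Forced and removed vertices in terms of neighbourhoods\<close>

definition nbr :: "player \<Rightarrow> 'a position \<Rightarrow> 'a \<Rightarrow> 'a set" where
  "nbr K G u = {v \<in> owned (opponent K) G. reaches K G u v}"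

lemma nbr_opponent_iff:
  "u \<in> owned K G \<Longrightarrow> v \<in> owned (opponent K) G \<Longrightarrow> u \<in> nbr (opponent K) G v \<longleftrightarrow> v \<in> nbr K G u"
  by (simp add: nbr_def reaches_opponent)

lemma Forc_eq:
  assumes pos: "game_position G"
  shows "Forc G = {x \<in> owned K G. nbr K G x = {}} \<union>
    {y \<in> owned (opponent K) G. nbr (opponent K) G y = {}}"
proof -
  have "Succ G x \<subseteq> lefts G \<longleftrightarrow> nbr Left G x = {}" for x
    using reaches_in_verts[OF pos, of Left x] owned_disjoint[OF pos, of Left] pos_verts_owned[of G Left]
    by (auto simp: Succ_def nbr_def)
  moreover have "Pred G x \<subseteq> rights G \<longleftrightarrow> nbr Right G x = {}" for x
    using reaches_in_verts[OF pos, of Right x] owned_disjoint[OF pos, of Left] pos_verts_owned[of G Left]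
    by (auto simp: Pred_def nbr_def)
  ultimately show ?thesis
    by (cases K) (auto simp: Forc_def)
qed

lemma nbr_nonempty:
  assumes "relevant G" "x \<in> owned K G"
  shows "nbr K G x \<noteq> {}"
  using assms Forc_eq[of G K] by (auto simp: relevant_def)

lemma nbr_subset_if_reaches:
  assumes "game_position G" "reaches K G x y"
  shows "nbr K G y \<subseteq> nbr K G x"
  using reaches_trans[OF assms] by (auto simp: nbr_def)

lemma Rmv_eq_Forc:
  assumes "game_position G" "u \<in> owned K G"
  shows "Rmv G u = {v. reaches K G u v} \<union> Forc (delete G {v. reaches K G u v})"
  using assms owned_disjoint[OF assms(1), of Left]
  by (cases K) (auto simp: Rmv_def Succ_def Pred_def)

text \<open>The set reached from \<open>u\<close> is closed under \<open>reaches K G\<close>, so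
  deleting it destroys no path to a vertex outside it. Hence the remaining opponent vertices keep
  their nonempty neighbourhoods and none is forced, while a remaining vertex of \<open>K\<close> is
  forced exactly when all its neighbours were reached from \<open>u\<close>.\<close>

lemma Rmv_eq:
  assumes rel: "relevant G" and u: "u \<in> owned K G"
  shows "Rmv G u = nbr K G u \<union> {w \<in> owned K G. nbr K G w \<subseteq> nbr K G u}"
proof -
  have pos: "game_position G" using rel by (simp add: relevant_def)
  define C where "C = {v. reaches K G u v}"
  have closed: "v \<in> C" if "z \<in> C" "reaches K G z v" for z v
    using that reaches_trans[OF pos] by (auto simp: C_def)
  have reach: "reaches K (delete G C) w v \<longleftrightarrow> reaches K G w v" if "v \<notin> C" for w v
    by (rule reaches_delete_iff[OF pos]) (use that closed in blast)
  have own: "nbr K (delete G C) w = nbr K G w - C" for w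
    using reach by (auto simp: nbr_def owned_delete)
  have "nbr (opponent K) (delete G C) v = nbr (opponent K) G v" if "v \<notin> C" for v
    using that reach closed by (auto simp: nbr_def owned_delete reaches_opponent)
  then have opp: "nbr (opponent K) (delete G C) v \<noteq> {}" if "v \<in> owned (opponent K) G - C" for v
    using that nbr_nonempty[OF rel, of v "opponent K"] by auto
  have "Forc (delete G C) = {w \<in> owned K G - C. nbr K G w \<subseteq> C}"
    using opp by (auto simp: Forc_eq[OF game_position_delete[OF pos], of C K] owned_delete own)
  then have "Rmv G u = C \<union> {w \<in> owned K G - C. nbr K G w \<subseteq> C}"
    using Rmv_eq_Forc[OF pos u] by (simp add: C_def)
  \<comment> \<open>By transitivity, the vertices of \<open>K\<close> reached from \<open>u\<close>
    also have their neighbourhoods inside that of \<open>u\<close>.\<close>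
  moreover have "C \<subseteq> nbr K G u \<union> {w \<in> owned K G. nbr K G w \<subseteq> nbr K G u}"
    using nbr_subset_if_reaches[OF pos, of K u] reaches_in_verts[OF pos, of K u]
    unfolding C_def pos_verts_owned[of G K] nbr_def[of K G u] by blast
  moreover have "nbr K G w \<subseteq> C \<longleftrightarrow> nbr K G w \<subseteq> nbr K G u" for w
    by (auto simp: C_def nbr_def)
  moreover have "nbr K G u \<subseteq> C" by (auto simp: C_def nbr_def)
  ultimately show ?thesis by blast
qed

section \<open>Neighbourhoods after a move\<close>

lemma reaches_after_iff:
  assumes rel: "relevant G" and u: "u \<in> owned K G"
    and v: "v \<in> owned (opponent K) G" "v \<notin> nbr K G u"
  shows "reaches K (after G u) w v \<longleftrightarrow> reaches K G w v"
  unfolding after_def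
proof (rule reaches_delete_iff)
  show pos: "game_position G" using rel by (simp add: relevant_def)
  show "z \<notin> Rmv G u" if zv: "reaches K G z v" for z
  proof
    assume "z \<in> Rmv G u"
    then consider "z \<in> nbr K G u" | "nbr K G z \<subseteq> nbr K G u"
      using Rmv_eq[OF rel u] by auto
    \<comment> \<open>\<open>nbr K\<close> is also meaningful for an opponent vertex
      \<open>z\<close>. In either case all opponent vertices reached from \<open>z\<close> are
      neighbours of \<open>u\<close>, whereas \<open>v\<close> is not.\<close>
    then have "nbr K G z \<subseteq> nbr K G u"
      using nbr_subset_if_reaches[OF pos, of K u z] by cases (simp_all add: nbr_def)
    then show False using zv v by (auto simp: nbr_def)
  qed
qed

lemma owned_after_mover:
  assumes "relevant G" "u \<in> owned K G"
  shows "owned K (after G u) = {w \<in> owned K G. \<not> nbr K G w \<subseteq> nbr K G u}"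
  using owned_disjoint[of G K] assms
  by (auto simp: after_def owned_delete Rmv_eq relevant_def nbr_def)

lemma owned_opponent_after_mover:
  assumes "relevant G" "u \<in> owned K G"
  shows "owned (opponent K) (after G u) = owned (opponent K) G - nbr K G u"
  using owned_disjoint[of G K] assms
  by (auto simp: after_def owned_delete Rmv_eq relevant_def)

lemma nbr_after_mover:
  assumes "relevant G" "u \<in> owned K G"
  shows "nbr K (after G u) w = nbr K G w - nbr K G u"
  using reaches_after_iff[OF assms] owned_opponent_after_mover[OF assms]
  by (auto simp: nbr_def)

lemma owned_after_opponent:
  assumes "relevant G" "y \<in> owned (opponent K) G"
  shows "owned K (after G y) = {w \<in> owned K G. y \<notin> nbr K G w}"
  using owned_opponent_after_mover[OF assms] nbr_opponent_iff[of _ K G y] assms(2) by auto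

lemma nbr_after_opponent:
  assumes rel: "relevant G" and y: "y \<in> owned (opponent K) G" and w: "w \<in> owned K (after G y)"
  shows "nbr K (after G y) w = nbr K G w"
proof -
  have wG: "w \<in> owned K G" "w \<notin> nbr (opponent K) G y"
    using w owned_opponent_after_mover[OF rel y] by auto
  have "reaches K (after G y) w v \<longleftrightarrow> reaches K G w v" for v
    using reaches_after_iff[OF rel y, of w v] wG by (simp add: reaches_opponent)
  \<comment> \<open>\<open>w\<close> is a neighbour of \<open>v\<close> but not of \<open>y\<close>,
    so the neighbourhood of \<open>v\<close> is not contained in that of \<open>y\<close> and
    \<open>v\<close> survives.\<close>
  moreover have "v \<in> owned (opponent K) (after G y)" if "v \<in> nbr K G w" for v
    using that wG owned_after_mover[OF rel y] nbr_opponent_iff[of w K G v]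
    by (auto simp: nbr_def)
  moreover have "owned (opponent K) (after G y) \<subseteq> owned (opponent K) G"
    by (auto simp: after_def owned_delete)
  ultimately show ?thesis by (auto simp: nbr_def)
qed

section \<open>Trimmings and their behaviour under moves\<close>

text \<open>Arcs are not compared because play depends on neighbourhoods only. The opponent's
  vertices need no clause: when \<open>H\<close> is relevant, each of them is a neighbour of some
  vertex of \<open>K\<close> in \<open>H\<close>.\<close>

definition trimming :: "player \<Rightarrow> 'a position \<Rightarrow> 'a position \<Rightarrow> bool" where
  "trimming K H G \<longleftrightarrow> owned K H \<subseteq> owned K G \<and> (\<forall>w \<in> owned K H. nbr K H w = nbr K G w)"

lemma trimming_after_opponent:
  assumes "relevant G" "y \<in> owned (opponent K) G"
  shows "trimming K (after G y) G"
  using owned_after_opponent[OF assms] nbr_after_opponent[OF assms] by (auto simp: trimming_def)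

lemma trimming_owned_opponent:
  assumes "trimming K H G" "relevant H"
  shows "owned (opponent K) H \<subseteq> owned (opponent K) G"
proof
  fix v assume v: "v \<in> owned (opponent K) H"
  then obtain w where "w \<in> nbr (opponent K) H v"
    using nbr_nonempty[OF assms(2)] by blast
  then have "w \<in> owned K H" "v \<in> nbr K H w"
    using v nbr_opponent_iff[of w K H v] by (auto simp: nbr_def)
  then show "v \<in> owned (opponent K) G"
    using assms(1) by (auto simp: trimming_def nbr_def)
qed

text \<open>Which vertices of \<open>K\<close> survive, and which neighbours they lose, is decided
  by comparison with the neighbourhood of \<open>x\<close>, which is the same in \<open>H\<close>
  and \<open>G\<close>.\<close>

lemma trimming_after_mover:
  assumes "trimming K H G" "relevant H" "relevant G" "x \<in> owned K H"
  shows "trimming K (after H x) (after G x)"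
  using assms
  by (auto simp: trimming_def owned_after_mover nbr_after_mover subset_iff)

lemma trimming_after_both:
  assumes tr: "trimming K H G" and rel: "relevant H" "relevant G" and y: "y \<in> owned (opponent K) H"
  shows "trimming K (after H y) (after G y)"
proof -
  have yG: "y \<in> owned (opponent K) G" using trimming_owned_opponent[OF tr rel(1)] y by blast
  have "owned K (after H y) \<subseteq> owned K (after G y)"
    using tr by (auto simp: trimming_def owned_after_opponent[OF rel(1) y] owned_after_opponent[OF rel(2) yG])
  then show ?thesis
    using tr nbr_after_opponent[OF rel(1) y] nbr_after_opponent[OF rel(2) yG]
      owned_after_opponent[OF rel(1) y]
    by (auto simp: trimming_def)
qed

text \<open>A vertex absent from \<open>H\<close> is a neighbour of no vertex of \<open>K\<close> in
  \<open>H\<close>, so taking it in \<open>G\<close> leaves all these vertices and their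
  neighbourhoods intact: a pass from the viewpoint of \<open>H\<close>.\<close>

lemma trimming_after_missing:
  assumes tr: "trimming K H G" and rel: "relevant G"
    and y: "y \<in> owned (opponent K) G" "y \<notin> owned (opponent K) H"
  shows "trimming K H (after G y)"
proof -
  have "y \<notin> nbr K H w" for w using y by (simp add: nbr_def)
  then have "owned K H \<subseteq> owned K (after G y)"
    using tr by (auto simp: trimming_def owned_after_opponent[OF rel y(1)])
  then show ?thesis
    using tr nbr_after_opponent[OF rel y(1)] by (auto simp: trimming_def)
qed

section \<open>Scores as attained extrema\<close>

lemma relevant_finite: "relevant G \<Longrightarrow> finite (pos_verts G)"
  by (simp add: relevant_def game_position_def pair_fin_digraph_def pair_fin_digraph_axioms_def)

lemma finite_owned: "relevant G \<Longrightarrow> finite (owned K G)"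
  using relevant_finite owned_subset_verts finite_subset by metis

text \<open>A copied move takes the same neighbours in \<open>G\<close>, and at least the same
  vertices of \<open>K\<close>, since \<open>G\<close> only offers more candidates.\<close>

lemma trimming_card_Rmv:
  assumes "trimming K H G" "relevant H" "relevant G" "x \<in> owned K H"
  shows "card (Rmv H x) \<le> card (Rmv G x)"
proof (rule card_mono)
  have xG: "x \<in> owned K G" using assms by (auto simp: trimming_def)
  have "Rmv G x \<subseteq> pos_verts G"
    using Rmv_eq[OF assms(3) xG] pos_verts_owned[of G K] by (auto simp: nbr_def)
  then show "finite (Rmv G x)"
    using relevant_finite[OF assms(3)] finite_subset by blast
  show "Rmv H x \<subseteq> Rmv G x"
    using assms by (auto simp: trimming_def Rmv_eq[OF assms(2,4)] Rmv_eq[OF assms(3) xG])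
qed

lemma score_first_ge:
  assumes "relevant G" "u \<in> owned K G"
  shows "card (Rmv G u) + score_second K (after G u) \<le> score_first K G"
  using assms owned_subset_verts[of K G] relevant_finite[of G] finite_owned[of G K]
  by (subst score_first.simps) (auto intro!: Max_ge)

lemma score_first_attained:
  assumes "relevant G" "pos_verts G \<noteq> {}"
  obtains u where "u \<in> owned K G" "score_first K G = card (Rmv G u) + score_second K (after G u)"
proof -
  let ?f = "\<lambda>u. card (Rmv G u) + score_second K (after G u)"
  have "Max (?f ` owned K G) \<in> ?f ` owned K G"
    using finite_owned[OF assms(1)] relevant_owned_nonempty[OF assms] by (intro Max_in) simp_all
  then show thesis
    using that assms relevant_finite[of G] by (auto simp: score_first.simps[of K G])
qed

lemma score_second_le:
  assumes "relevant G" "y \<in> owned (opponent K) G"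
  shows "score_second K G \<le> score_first K (after G y)"
  using assms owned_subset_verts[of "opponent K" G] relevant_finite[of G] finite_owned[of G "opponent K"]
  by (subst score_second.simps) (auto intro!: Min_le)

lemma score_second_attained:
  assumes "relevant G" "pos_verts G \<noteq> {}"
  obtains y where "y \<in> owned (opponent K) G" "score_second K G = score_first K (after G y)"
proof -
  let ?f = "\<lambda>y. score_first K (after G y)"
  have "Min (?f ` owned (opponent K) G) \<in> ?f ` owned (opponent K) G"
    using finite_owned[OF assms(1)] relevant_owned_nonempty[OF assms] by (intro Min_in) simp_all
  then show thesis
    using that assms relevant_finite[of G] by (auto simp: score_second.simps[of K G])
qed

lemma score_empty:
  assumes "pos_verts G = {}"
  shows "score_first K G = 0" "score_second K G = 0"
  using assms by (simp_all add: score_first.simps[of K G] score_second.simps[of K G])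

section \<open>The simultaneous induction\<close>

lemma trimming_scores_and_first_ge_second:
  assumes "relevant G"
  shows "(\<forall>H. relevant H \<longrightarrow> trimming K H G \<longrightarrow>
      score_first K H \<le> score_first K G \<and> score_second K H \<le> score_second K G) \<and>
    score_second K G \<le> score_first K G"
  using assms
proof (induction "card (pos_verts G)" arbitrary: G rule: less_induct)
  case less
  note rel = less.prems
  have smaller: "card (pos_verts (after G u)) < card (pos_verts G)" if "u \<in> owned J G" for u J
    using card_after_less[OF relevant_finite[OF rel] subsetD[OF owned_subset_verts that]] .
  \<comment> \<open>The mover \<open>J\<close> is arbitrary, whereas the scoring player
    \<open>K\<close> stays fixed throughout the induction.\<close>
  have mono_after: "score_first K H \<le> score_first K (after G u)"
      "score_second K H \<le> score_second K (after G u)"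
    if "u \<in> owned J G" "relevant H" "trimming K H (after G u)" for u H J
    using less.hyps[OF smaller[OF that(1)] relevant_after[OF rel]] that(2,3) by auto
  have first_mono: "score_first K H \<le> score_first K G" if H: "relevant H" "trimming K H G" for H
  \<comment> \<open>An empty \<open>H\<close> has score 0 by default, which makes the bound trivial;
    otherwise an optimal opening \<open>x\<close> in \<open>H\<close> is copied in
    \<open>G\<close>.\<close>
  proof (cases "pos_verts H = {}")
    case False
    then obtain x where x: "x \<in> owned K H"
      "score_first K H = card (Rmv H x) + score_second K (after H x)"
      using score_first_attained[OF H(1)] by metis
    have xG: "x \<in> owned K G" using x(1) H(2) by (auto simp: trimming_def)
    have "card (Rmv H x) \<le> card (Rmv G x)"
      using trimming_card_Rmv[OF H(2,1) rel x(1)] .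
    moreover have "score_second K (after H x) \<le> score_second K (after G x)"
      using mono_after(2)[OF xG relevant_after[OF H(1)] trimming_after_mover[OF H(2,1) rel x(1)]] .
    ultimately show ?thesis
      using x(2) score_first_ge[OF rel xG] by linarith
  qed (simp add: score_empty)
  have second_mono: "score_second K H \<le> score_second K G" if H: "relevant H" "trimming K H G" for H
  proof (cases "pos_verts H = {}")
    case False
    have HG: "pos_verts H \<subseteq> pos_verts G"
      using trimming_owned_opponent[OF H(2,1)] H(2)
      by (auto simp: trimming_def pos_verts_owned[of _ K] simp del: with_proj_simps)
    with False have "pos_verts G \<noteq> {}" by blast
    \<comment> \<open>The opponent's best opening in \<open>G\<close>; if \<open>H\<close> contains
      it too, it bounds the score in \<open>H\<close> from above.\<close>
    then obtain y where y: "y \<in> owned (opponent K) G" "score_second K G = score_first K (after G y)"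
      using score_second_attained[OF rel] by metis
    show ?thesis
    proof (cases "y \<in> owned (opponent K) H")
      case True
      have "score_first K (after H y) \<le> score_first K (after G y)"
        using mono_after(1)[OF y(1) relevant_after[OF H(1)] trimming_after_both[OF H(2,1) rel True]] .
      then show ?thesis using score_second_le[OF H(1) True] y(2) by linarith
    next
      case missing: False
      have "y \<notin> owned K H"
        using H(2) y(1) owned_disjoint[of G K] rel by (auto simp: trimming_def relevant_def)
      then have "pos_verts H \<subset> pos_verts G"
        using HG missing y(1) owned_subset_verts[of "opponent K" G] pos_verts_owned[of H K] by blast
      \<comment> \<open>The second half of the induction hypothesis, applied to the strictly smaller
        \<open>H\<close> itself: after the opponent's pass, \<open>K\<close> is to move in
        \<open>H\<close>.\<close>
      then have "score_second K H \<le> score_first K H"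
        using less.hyps H(1) psubset_card_mono[OF relevant_finite[OF rel]] by blast
      also have "\<dots> \<le> score_first K (after G y)"
        using mono_after(1)[OF y(1) H(1) trimming_after_missing[OF H(2) rel y(1) missing]] .
      finally show ?thesis using y(2) by simp
    qed
  qed (simp add: score_empty)
  have "score_second K G \<le> score_first K G"
  proof (cases "pos_verts G = {}")
    case False
    then obtain y where y: "y \<in> owned (opponent K) G"
      using relevant_owned_nonempty[OF rel] by blast
    \<comment> \<open>Any opponent move \<open>y\<close> will do. \<open>first_mono\<close> is used
      for \<open>G\<close> itself, with \<open>after G y\<close> as the trimming.\<close>
    then show ?thesis
      using score_second_le[OF rel y] first_mono[OF relevant_after[OF rel] trimming_after_opponent[OF rel y]]
      by linarith
  qed (simp add: score_empty)
  then show ?case using first_mono second_mono by blast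
qed

theorem corollary12:
  fixes G :: "'a position" and K :: player
  assumes "relevant G"
  shows "score_first K G \<ge> score_second K G"
  using trimming_scores_and_first_ge_second[OF assms] by blast

end
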